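(* (1) Let $(V,\Delta,\varepsilon)$ be a counital coassociative coalgebra in a strict monoidal category $(\mathcal C,\otimes,\mathbf I)$. (a) The morphism $\sigma_{coAss}:=\varepsilon\otimes\Delta:V\otimes V\to V\otimes V$ is a pre-braiding on $V$. (b) Any coalgebra co-character $e:\mathbf I\to V$ is a braided co-character for $(V,\sigma_{coAss})$. (2) Let $(V,\partial,\varepsilon)$ be a counital co-Leibniz coalgebra in a symmetric preadditive strict monoidal category $(\mathcal C,\otimes,\mathbf I,c)$. (a) The morphism $\sigma_{coLei}:=c_{V,V}+\varepsilon\otimes\partial:V\otimes V\to V\otimes V$ is a braiding on $V$. (b) Any co-Lie co-character $e:\mathbf I\to V$ is a braided co-character for $(V,\sigma_{coLei})$.
   Context: In a preadditive monoidal category, $\otimes$ is additive in each variable; $c$ denotes the symmetric braiding of $\mathcal C$. A pre-braiding on $V$ is a morphism $\sigma:V\otimes V\to V\otimes V$ with $(\sigma\otimes\mathrm{Id}_V)(\mathrm{Id}_V\otimes\sigma)(\sigma\otimes\mathrm{Id}_V)=(\mathrm{Id}_V\otimes\sigma)(\sigma\otimes\mathrm{Id}_V)(\mathrm{Id}_V\otimes\sigma)$; a braiding is an invertible pre-braiding. A braided co-character for $(V,\sigma)$ is $e:\mathbf I\to V$ with $\sigma\circ(e\otimes e)=e\otimes e$. A counital coassociative coalgebra: $\Delta:V\to V\otimes V$ coassociative, $\varepsilon:V\to\mathbf I$ with $(\varepsilon\otimes\mathrm{Id}_V)\Delta=(\mathrm{Id}_V\otimes\varepsilon)\Delta=\mathrm{Id}_V$.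 A coalgebra co-character is $e:\mathbf I\to V$ with $\Delta\circ e=e\otimes e$ and $\varepsilon\circ e=\mathrm{Id}_{\mathbf I}$. A counital co-Leibniz coalgebra: $\partial:V\to V\otimes V$, $\varepsilon:V\to\mathbf I$ with $(\mathrm{Id}_V\otimes\partial)\partial=(\partial\otimes\mathrm{Id}_V)\partial-(\mathrm{Id}_V\otimes c_{V,V})(\partial\otimes\mathrm{Id}_V)\partial$ and $(\mathrm{Id}_V\otimes\varepsilon)\partial=(\varepsilon\otimes\mathrm{Id}_V)\partial=0$. A co-Lie co-character is $e:\mathbf I\to V$ with $\partial\circ e=0$ and $\varepsilon\circ e=\mathrm{Id}_{\mathbf I}$. *)

theory Defs
  imports "HOL-Algebra.Group"
begin

text \<open>
  Every arrow carries its own domain and codomain. All operations are total functions;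
  they are only constrained on objects, arrows, composable pairs and (for addition)
  parallel pairs of arrows.
\<close>

record ('o, 'm) category =
  Obj   :: "'o set"
  Arr   :: "'m set"
  Dom   :: "'m \<Rightarrow> 'o"
  Cod   :: "'m \<Rightarrow> 'o"
  ident :: "'o \<Rightarrow> 'm"  (\<open>\<i>\<d>\<index>\<close>)
  cmp   :: "'m \<Rightarrow> 'm \<Rightarrow> 'm"  (infixr \<open>\<cdot>\<index>\<close> 65)

definition hom_set :: "('o, 'm, 'z) category_scheme \<Rightarrow> 'o \<Rightarrow> 'o \<Rightarrow> 'm set"  (\<open>Hom\<index>\<close>)
  where "hom_set C A B = {f \<in> Arr C. Dom C f = A \<and> Cod C f = B}"

locale category =
  fixes C :: "('o, 'm, 'z) category_scheme" (structure)
  assumes Dom_in_Obj: "f \<in> Arr C \<Longrightarrow> Dom C f \<in> Obj C"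
    and Cod_in_Obj: "f \<in> Arr C \<Longrightarrow> Cod C f \<in> Obj C"
    and ident_in_Hom: "A \<in> Obj C \<Longrightarrow> \<i>\<d> A \<in> Hom A A"
    and cmp_in_Hom: "\<lbrakk>g \<in> Hom B D; f \<in> Hom A B\<rbrakk> \<Longrightarrow> g \<cdot> f \<in> Hom A D"
    and ident_cmp: "f \<in> Hom A B \<Longrightarrow> \<i>\<d> B \<cdot> f = f"
    and cmp_ident: "f \<in> Hom A B \<Longrightarrow> f \<cdot> \<i>\<d> A = f"
    and cmp_assoc: "\<lbrakk>h \<in> Hom D E; g \<in> Hom B D; f \<in> Hom A B\<rbrakk>
                      \<Longrightarrow> (h \<cdot> g) \<cdot> f = h \<cdot> (g \<cdot> f)"

record ('o, 'm) monoidal_category = "('o, 'm) category" +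
  tensor_obj :: "'o \<Rightarrow> 'o \<Rightarrow> 'o"  (infixr \<open>\<otimes>\<^sub>o\<index>\<close> 70)
  tensor_arr :: "'m \<Rightarrow> 'm \<Rightarrow> 'm"  (infixr \<open>\<otimes>\<^sub>m\<index>\<close> 70)
  unit_obj   :: "'o"  (\<open>\<I>\<index>\<close>)

locale strict_monoidal_category = category C
  for C :: "('o, 'm, 'z) monoidal_category_scheme" (structure) +
  assumes unit_in_Obj: "\<I> \<in> Obj C"
    and tensor_in_Obj: "\<lbrakk>A \<in> Obj C; B \<in> Obj C\<rbrakk> \<Longrightarrow> A \<otimes>\<^sub>o B \<in> Obj C"
    and tensor_in_Hom: "\<lbrakk>f \<in> Hom A B; g \<in> Hom A' B'\<rbrakk>
                          \<Longrightarrow> f \<otimes>\<^sub>m g \<in> Hom (A \<otimes>\<^sub>o A') (B \<otimes>\<^sub>o B')"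
    and tensor_ident: "\<lbrakk>A \<in> Obj C; B \<in> Obj C\<rbrakk> \<Longrightarrow> \<i>\<d> A \<otimes>\<^sub>m \<i>\<d> B = \<i>\<d> (A \<otimes>\<^sub>o B)"
    and interchange: "\<lbrakk>g \<in> Hom B D; f \<in> Hom A B; g' \<in> Hom B' D'; f' \<in> Hom A' B'\<rbrakk>
                        \<Longrightarrow> (g \<cdot> f) \<otimes>\<^sub>m (g' \<cdot> f') = (g \<otimes>\<^sub>m g') \<cdot> (f \<otimes>\<^sub>m f')"
    and tensor_obj_assoc: "\<lbrakk>A \<in> Obj C; B \<in> Obj C; D \<in> Obj C\<rbrakk>
                             \<Longrightarrow> (A \<otimes>\<^sub>o B) \<otimes>\<^sub>o D = A \<otimes>\<^sub>o (B \<otimes>\<^sub>o D)"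
    and unit_tensor_obj: "A \<in> Obj C \<Longrightarrow> \<I> \<otimes>\<^sub>o A = A"
    and tensor_obj_unit: "A \<in> Obj C \<Longrightarrow> A \<otimes>\<^sub>o \<I> = A"
    and tensor_arr_assoc: "\<lbrakk>f \<in> Arr C; g \<in> Arr C; h \<in> Arr C\<rbrakk>
                             \<Longrightarrow> (f \<otimes>\<^sub>m g) \<otimes>\<^sub>m h = f \<otimes>\<^sub>m (g \<otimes>\<^sub>m h)"
    and unit_tensor_arr: "f \<in> Arr C \<Longrightarrow> \<i>\<d> \<I> \<otimes>\<^sub>m f = f"
    and tensor_arr_unit: "f \<in> Arr C \<Longrightarrow> f \<otimes>\<^sub>m \<i>\<d> \<I> = f"

locale symmetric_strict_monoidal_category = strict_monoidal_category C
  for C :: "('o, 'm, 'z) monoidal_category_scheme" (structure) +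
  fixes c :: "'o \<Rightarrow> 'o \<Rightarrow> 'm"
  assumes braid_in_Hom: "\<lbrakk>A \<in> Obj C; B \<in> Obj C\<rbrakk> \<Longrightarrow> c A B \<in> Hom (A \<otimes>\<^sub>o B) (B \<otimes>\<^sub>o A)"
    and braid_natural: "\<lbrakk>f \<in> Hom A A'; g \<in> Hom B B'\<rbrakk>
                          \<Longrightarrow> c A' B' \<cdot> (f \<otimes>\<^sub>m g) = (g \<otimes>\<^sub>m f) \<cdot> c A B"
    and braid_tensor_right: "\<lbrakk>A \<in> Obj C; B \<in> Obj C; D \<in> Obj C\<rbrakk>
                               \<Longrightarrow> c A (B \<otimes>\<^sub>o D) = (\<i>\<d> B \<otimes>\<^sub>m c A D) \<cdot> (c A B \<otimes>\<^sub>m \<i>\<d> D)"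
    and braid_tensor_left: "\<lbrakk>A \<in> Obj C; B \<in> Obj C; D \<in> Obj C\<rbrakk>
                              \<Longrightarrow> c (A \<otimes>\<^sub>o B) D = (c A D \<otimes>\<^sub>m \<i>\<d> B) \<cdot> (\<i>\<d> A \<otimes>\<^sub>m c B D)"
    and braid_symmetric: "\<lbrakk>A \<in> Obj C; B \<in> Obj C\<rbrakk> \<Longrightarrow> c B A \<cdot> c A B = \<i>\<d> (A \<otimes>\<^sub>o B)"

record ('o, 'm) preadditive_monoidal_category = "('o, 'm) monoidal_category" +
  add_arr  :: "'m \<Rightarrow> 'm \<Rightarrow> 'm"  (infixl \<open>\<boxplus>\<index>\<close> 60)
  zero_arr :: "'o \<Rightarrow> 'o \<Rightarrow> 'm"  (\<open>\<z>\<index>\<close>)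

definition hom_group ::
    "('o, 'm, 'z) preadditive_monoidal_category_scheme \<Rightarrow> 'o \<Rightarrow> 'o \<Rightarrow> 'm monoid"
  where "hom_group C A B =
    \<lparr>carrier = hom_set C A B, monoid.mult = add_arr C, one = zero_arr C A B\<rparr>"

definition diff_arr ::
    "('o, 'm, 'z) preadditive_monoidal_category_scheme \<Rightarrow> 'm \<Rightarrow> 'm \<Rightarrow> 'm"
    (infixl \<open>\<boxminus>\<index>\<close> 60)
  where "diff_arr C f g = add_arr C f (m_inv (hom_group C (Dom C g) (Cod C g)) g)"

locale preadditive_strict_monoidal_category = strict_monoidal_category C
  for C :: "('o, 'm, 'z) preadditive_monoidal_category_scheme" (structure) +
  assumes hom_comm_group: "\<lbrakk>A \<in> Obj C; B \<in> Obj C\<rbrakk> \<Longrightarrow> comm_group (hom_group C A B)"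
    and cmp_add_left: "\<lbrakk>g \<in> Hom B D; g' \<in> Hom B D; f \<in> Hom A B\<rbrakk>
                         \<Longrightarrow> (g \<boxplus> g') \<cdot> f = g \<cdot> f \<boxplus> g' \<cdot> f"
    and cmp_add_right: "\<lbrakk>g \<in> Hom B D; f \<in> Hom A B; f' \<in> Hom A B\<rbrakk>
                          \<Longrightarrow> g \<cdot> (f \<boxplus> f') = g \<cdot> f \<boxplus> g \<cdot> f'"
    and tensor_add_left: "\<lbrakk>f \<in> Hom A B; f' \<in> Hom A B; g \<in> Hom A' B'\<rbrakk>
                            \<Longrightarrow> (f \<boxplus> f') \<otimes>\<^sub>m g = f \<otimes>\<^sub>m g \<boxplus> f' \<otimes>\<^sub>m g"
    and tensor_add_right: "\<lbrakk>f \<in> Hom A B; g \<in> Hom A' B'; g' \<in> Hom A' B'\<rbrakk>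
                             \<Longrightarrow> f \<otimes>\<^sub>m (g \<boxplus> g') = f \<otimes>\<^sub>m g \<boxplus> f \<otimes>\<^sub>m g'"

locale symmetric_preadditive_strict_monoidal_category =
  preadditive_strict_monoidal_category C + symmetric_strict_monoidal_category C c
  for C :: "('o, 'm, 'z) preadditive_monoidal_category_scheme" (structure)
    and c :: "'o \<Rightarrow> 'o \<Rightarrow> 'm"

context
  fixes C :: "('o, 'm, 'z) monoidal_category_scheme" (structure)
begin

definition is_iso :: "'o \<Rightarrow> 'o \<Rightarrow> 'm \<Rightarrow> bool"
  where "is_iso A B f \<longleftrightarrow>
    f \<in> Hom A B \<and> (\<exists>g \<in> Hom B A. g \<cdot> f = \<i>\<d> A \<and> f \<cdot> g = \<i>\<d> B)"

definition pre_braiding :: "'o \<Rightarrow> 'm \<Rightarrow> bool"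
  where "pre_braiding V \<sigma> \<longleftrightarrow>
    V \<in> Obj C \<and> \<sigma> \<in> Hom (V \<otimes>\<^sub>o V) (V \<otimes>\<^sub>o V) \<and>
    (\<sigma> \<otimes>\<^sub>m \<i>\<d> V) \<cdot> (\<i>\<d> V \<otimes>\<^sub>m \<sigma>) \<cdot> (\<sigma> \<otimes>\<^sub>m \<i>\<d> V)
      = (\<i>\<d> V \<otimes>\<^sub>m \<sigma>) \<cdot> (\<sigma> \<otimes>\<^sub>m \<i>\<d> V) \<cdot> (\<i>\<d> V \<otimes>\<^sub>m \<sigma>)"

definition braiding :: "'o \<Rightarrow> 'm \<Rightarrow> bool"
  where "braiding V \<sigma> \<longleftrightarrow> pre_braiding V \<sigma> \<and> is_iso (V \<otimes>\<^sub>o V) (V \<otimes>\<^sub>o V) \<sigma>"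

definition braided_cocharacter :: "'o \<Rightarrow> 'm \<Rightarrow> 'm \<Rightarrow> bool"
  where "braided_cocharacter V \<sigma> e \<longleftrightarrow>
    e \<in> Hom \<I> V \<and> \<sigma> \<cdot> (e \<otimes>\<^sub>m e) = e \<otimes>\<^sub>m e"

definition counital_coassociative_coalgebra :: "'o \<Rightarrow> 'm \<Rightarrow> 'm \<Rightarrow> bool"
  where "counital_coassociative_coalgebra V \<Delta> \<epsilon> \<longleftrightarrow>
    V \<in> Obj C \<and> \<Delta> \<in> Hom V (V \<otimes>\<^sub>o V) \<and> \<epsilon> \<in> Hom V \<I> \<and>
    (\<Delta> \<otimes>\<^sub>m \<i>\<d> V) \<cdot> \<Delta> = (\<i>\<d> V \<otimes>\<^sub>m \<Delta>) \<cdot> \<Delta> \<and>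
    (\<epsilon> \<otimes>\<^sub>m \<i>\<d> V) \<cdot> \<Delta> = \<i>\<d> V \<and>
    (\<i>\<d> V \<otimes>\<^sub>m \<epsilon>) \<cdot> \<Delta> = \<i>\<d> V"

definition coalgebra_cocharacter :: "'o \<Rightarrow> 'm \<Rightarrow> 'm \<Rightarrow> 'm \<Rightarrow> bool"
  where "coalgebra_cocharacter V \<Delta> \<epsilon> e \<longleftrightarrow>
    e \<in> Hom \<I> V \<and> \<Delta> \<cdot> e = e \<otimes>\<^sub>m e \<and> \<epsilon> \<cdot> e = \<i>\<d> \<I>"

text \<open>
  Since the category is strict, \<open>V \<otimes>\<^sub>o V\<close> and \<open>\<I> \<otimes>\<^sub>o (V \<otimes>\<^sub>o V)\<close> are the same object, so
  \<open>\<epsilon> \<otimes>\<^sub>m \<Delta>\<close> is an endomorphism of \<open>V \<otimes>\<^sub>o V\<close>. Likewise the targets of \<open>\<epsilon> \<otimes>\<^sub>m \<i>\<d> V\<close> and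
  \<open>\<i>\<d> V \<otimes>\<^sub>m \<epsilon>\<close> are \<open>V\<close>.
\<close>

definition sigma_coAss :: "'m \<Rightarrow> 'm \<Rightarrow> 'm"
  where "sigma_coAss \<Delta> \<epsilon> = \<epsilon> \<otimes>\<^sub>m \<Delta>"

end

context
  fixes C :: "('o, 'm, 'z) preadditive_monoidal_category_scheme" (structure)
begin

definition counital_coLeibniz_coalgebra ::
    "('o \<Rightarrow> 'o \<Rightarrow> 'm) \<Rightarrow> 'o \<Rightarrow> 'm \<Rightarrow> 'm \<Rightarrow> bool"
  where "counital_coLeibniz_coalgebra c V \<delta> \<epsilon> \<longleftrightarrow>
    V \<in> Obj C \<and> \<delta> \<in> Hom V (V \<otimes>\<^sub>o V) \<and> \<epsilon> \<in> Hom V \<I> \<and>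
    (\<i>\<d> V \<otimes>\<^sub>m \<delta>) \<cdot> \<delta>
      = (\<delta> \<otimes>\<^sub>m \<i>\<d> V) \<cdot> \<delta> \<boxminus> (\<i>\<d> V \<otimes>\<^sub>m c V V) \<cdot> (\<delta> \<otimes>\<^sub>m \<i>\<d> V) \<cdot> \<delta> \<and>
    (\<i>\<d> V \<otimes>\<^sub>m \<epsilon>) \<cdot> \<delta> = \<z> V V \<and>
    (\<epsilon> \<otimes>\<^sub>m \<i>\<d> V) \<cdot> \<delta> = \<z> V V"

definition coLie_cocharacter :: "'o \<Rightarrow> 'm \<Rightarrow> 'm \<Rightarrow> 'm \<Rightarrow> bool"
  where "coLie_cocharacter V \<delta> \<epsilon> e \<longleftrightarrow>
    e \<in> Hom \<I> V \<and> \<delta> \<cdot> e = \<z> \<I> (V \<otimes>\<^sub>o V) \<and> \<epsilon> \<cdot> e = \<i>\<d> \<I>"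

definition sigma_coLei :: "('o \<Rightarrow> 'o \<Rightarrow> 'm) \<Rightarrow> 'o \<Rightarrow> 'm \<Rightarrow> 'm \<Rightarrow> 'm"
  where "sigma_coLei c V \<delta> \<epsilon> = c V V \<boxplus> \<epsilon> \<otimes>\<^sub>m \<delta>"

end

end

theory Submission
  imports Defs "HOL-Algebra.Ring"
begin

text \<open>
  In Sweedler-style notation the coassociative braiding is \<open>v w \<mapsto> \<epsilon>(v) w\<^sub>1 w\<^sub>2\<close>. Both sides of
  its Yang--Baxter equation send \<open>u v w\<close> to \<open>\<epsilon>(u) \<epsilon>(v)\<close> times an iterated coproduct of \<open>w\<close>, and
  the two iterated coproducts agree by coassociativity (\<open>pre_braiding_sigma_coAss\<close>).

  The co-Leibniz braiding is a perturbation \<open>c + t\<close> of the symmetry, where \<open>t = \<epsilon> \<otimes> \<delta>\<close>. Its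
  properties are identities in the endomorphism rings of \<open>V \<otimes> V\<close> and \<open>V \<otimes> V \<otimes> V\<close>. Expanding
  both sides of the Yang--Baxter equation gives eight terms each. Those with at most one \<open>t\<close> match
  because \<open>c\<close> is a natural symmetry. Among the others, every term in which a counit meets a leg of
  \<open>\<delta>\<close> vanishes. The three survivors are \<open>\<epsilon>(u) \<epsilon>(v)\<close> times \<open>w\<^sub>1\<^sub>1 w\<^sub>1\<^sub>2 w\<^sub>2\<close>, \<open>w\<^sub>1 w\<^sub>2\<^sub>1 w\<^sub>2\<^sub>2\<close> and
  \<open>w\<^sub>1\<^sub>1 w\<^sub>2 w\<^sub>1\<^sub>2\<close>, and their equation is the co-Leibniz identity. The ring-theoretic part is
  \<open>yang_baxter_perturbation\<close>, the diagrammatic input is \<open>t2_t1\<close>, \<open>t1_c2_t1\<close> and \<open>t1_t2_c1\<close>.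
  Invertibility holds because \<open>t c t = 0\<close>, so that \<open>c - c t c\<close> is the inverse.

  On \<open>e \<otimes> e\<close> the counit is absorbed by \<open>\<epsilon> e = 1\<close>. There \<open>\<epsilon> \<otimes> \<Delta>\<close> acts as \<open>\<Delta> e = e \<otimes> e\<close>, and
  \<open>c + \<epsilon> \<otimes> \<delta>\<close> acts as \<open>c\<close>, which fixes \<open>e \<otimes> e\<close> since \<open>c\<close> is trivial on the unit object.
\<close>

section \<open>Calculus in strict monoidal categories\<close>

context category
begin

text \<open>Typing an arrow by separate equations for domain and codomain, instead of by membership in a
  hom-set, lets the simplifier compare objects up to the strict associativity and unit laws.\<close>

lemma Hom_iff: "f \<in> Hom A B \<longleftrightarrow> f \<in> Arr C \<and> Dom C f = A \<and> Cod C f = B"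
  by (simp add: hom_set_def)

lemma ident_typing [simp]:
  assumes "A \<in> Obj C"
  shows "\<i>\<d> A \<in> Arr C" "Dom C (\<i>\<d> A) = A" "Cod C (\<i>\<d> A) = A"
  using ident_in_Hom[OF assms] by (simp_all add: Hom_iff)

lemma cmp_typing [simp]:
  assumes "f \<in> Arr C" "g \<in> Arr C" "Dom C g = Cod C f"
  shows "g \<cdot> f \<in> Arr C" "Dom C (g \<cdot> f) = Dom C f" "Cod C (g \<cdot> f) = Cod C g"
  using cmp_in_Hom[of g "Cod C f" "Cod C g" f "Dom C f"] assms by (simp_all add: Hom_iff)

lemma cmp_ident_simps [simp]:
  assumes "f \<in> Arr C"
  shows "Cod C f = A \<Longrightarrow> \<i>\<d> A \<cdot> f = f" "Dom C f = A \<Longrightarrow> f \<cdot> \<i>\<d> A = f"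
  using ident_cmp[of f "Dom C f" "Cod C f"] cmp_ident[of f "Dom C f" "Cod C f"] assms
  by (auto simp add: Hom_iff)

lemma cmp_assoc_Arr:
  assumes "f \<in> Arr C" "g \<in> Arr C" "h \<in> Arr C" "Dom C g = Cod C f" "Dom C h = Cod C g"
  shows "(h \<cdot> g) \<cdot> f = h \<cdot> (g \<cdot> f)"
  using assms by (intro cmp_assoc) (simp_all add: Hom_iff)

end

context strict_monoidal_category
begin

lemmas tensor_obj_simps [simp] =
  unit_in_Obj tensor_in_Obj tensor_obj_assoc unit_tensor_obj tensor_obj_unit

lemmas tensor_arr_simps [simp] =
  tensor_ident tensor_arr_assoc unit_tensor_arr tensor_arr_unit

lemma tensor_typing [simp]:
  assumes "f \<in> Arr C" "g \<in> Arr C"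
  shows "f \<otimes>\<^sub>m g \<in> Arr C"
    "Dom C (f \<otimes>\<^sub>m g) = Dom C f \<otimes>\<^sub>o Dom C g"
    "Cod C (f \<otimes>\<^sub>m g) = Cod C f \<otimes>\<^sub>o Cod C g"
  using tensor_in_Hom[of f "Dom C f" "Cod C f" g "Dom C g" "Cod C g"] assms
  by (simp_all add: Hom_iff)

lemma interchange_Arr:
  assumes "f \<in> Arr C" "g \<in> Arr C" "f' \<in> Arr C" "g' \<in> Arr C"
    and "Dom C g = Cod C f" "Dom C g' = Cod C f'"
  shows "(g \<otimes>\<^sub>m g') \<cdot> (f \<otimes>\<^sub>m f') = (g \<cdot> f) \<otimes>\<^sub>m (g' \<cdot> f')"
  using assms by (intro interchange[symmetric]) (simp_all add: Hom_iff)

text \<open>In a strict category \<open>h\<close> is the same arrow as \<open>\<i>\<d> \<I> \<otimes>\<^sub>m h\<close>. So a strand that has ended in the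
  unit object is no obstacle to composing on the other strands. This rule drives all the diagram
  computations below, where the ended strands are those on which a counit has been applied.\<close>

lemma cmp_tensor_ended_strand:
  assumes "f \<in> Arr C" "g \<in> Arr C" "h \<in> Arr C" "Cod C f = \<I>" "Dom C h = Cod C g"
  shows "h \<cdot> (f \<otimes>\<^sub>m g) = f \<otimes>\<^sub>m (h \<cdot> g)"
  using interchange_Arr[of f "\<i>\<d> \<I>" g h] assms by simp

lemma counit_tensor_cmp_cocharacter:
  assumes "e \<in> Hom \<I> V" "\<epsilon> \<in> Hom V \<I>" "\<Delta> \<in> Hom V (V \<otimes>\<^sub>o V)" "\<epsilon> \<cdot> e = \<i>\<d> \<I>"
  shows "(\<epsilon> \<otimes>\<^sub>m \<Delta>) \<cdot> (e \<otimes>\<^sub>m e) = \<Delta> \<cdot> e"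
  using assms by (simp add: Hom_iff interchange_Arr)

section \<open>Coassociative coalgebras\<close>

text \<open>Both sides of the Yang--Baxter equation apply \<open>\<epsilon>\<close> to the first two strands and an iterated
  coproduct to the third. The counit law removes the two redundant coproducts, and coassociativity
  identifies the remaining iterated ones.\<close>

lemma pre_braiding_sigma_coAss:
  assumes "counital_coassociative_coalgebra C V \<Delta> \<epsilon>"
  shows "pre_braiding C V (sigma_coAss C \<Delta> \<epsilon>)"
proof -
  have V [simp]: "V \<in> Obj C"
    and D [simp]: "\<Delta> \<in> Arr C" "Dom C \<Delta> = V" "Cod C \<Delta> = V \<otimes>\<^sub>o V"
    and E [simp]: "\<epsilon> \<in> Arr C" "Dom C \<epsilon> = V" "Cod C \<epsilon> = \<I>"
    and coassoc: "(\<Delta> \<otimes>\<^sub>m \<i>\<d> V) \<cdot> \<Delta> = (\<i>\<d> V \<otimes>\<^sub>m \<Delta>) \<cdot> \<Delta>"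
    and counit: "(\<i>\<d> V \<otimes>\<^sub>m \<epsilon>) \<cdot> \<Delta> = \<i>\<d> V"
    using assms by (simp_all add: counital_coassociative_coalgebra_def Hom_iff)
  let ?s1 = "\<epsilon> \<otimes>\<^sub>m \<Delta> \<otimes>\<^sub>m \<i>\<d> V" and ?s2 = "\<i>\<d> V \<otimes>\<^sub>m \<epsilon> \<otimes>\<^sub>m \<Delta>"
  have absorb: "?s2 \<cdot> (\<Delta> \<otimes>\<^sub>m \<i>\<d> V) = \<i>\<d> V \<otimes>\<^sub>m \<Delta>"
    using interchange_Arr[of \<Delta> "\<i>\<d> V \<otimes>\<^sub>m \<epsilon>" "\<i>\<d> V" \<Delta>] by (simp add: counit)
  have s21: "?s2 \<cdot> ?s1 = \<epsilon> \<otimes>\<^sub>m \<i>\<d> V \<otimes>\<^sub>m \<Delta>"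
    by (simp add: cmp_tensor_ended_strand absorb)
  have lhs: "?s1 \<cdot> ?s2 \<cdot> ?s1 = \<epsilon> \<otimes>\<^sub>m \<epsilon> \<otimes>\<^sub>m ((\<Delta> \<otimes>\<^sub>m \<i>\<d> V) \<cdot> \<Delta>)"
    unfolding s21 by (simp add: cmp_tensor_ended_strand interchange_Arr)
  have s12: "?s1 \<cdot> ?s2 = \<epsilon> \<otimes>\<^sub>m \<epsilon> \<otimes>\<^sub>m ((\<Delta> \<otimes>\<^sub>m \<i>\<d> V) \<cdot> \<Delta>)"
    by (simp add: cmp_tensor_ended_strand interchange_Arr)
  have "?s2 \<cdot> (\<Delta> \<otimes>\<^sub>m \<i>\<d> V) \<cdot> \<Delta> = (\<i>\<d> V \<otimes>\<^sub>m \<Delta>) \<cdot> \<Delta>"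
    using cmp_assoc_Arr[of \<Delta> "\<Delta> \<otimes>\<^sub>m \<i>\<d> V" ?s2] by (simp add: absorb)
  then have rhs: "?s2 \<cdot> ?s1 \<cdot> ?s2 = \<epsilon> \<otimes>\<^sub>m \<epsilon> \<otimes>\<^sub>m ((\<i>\<d> V \<otimes>\<^sub>m \<Delta>) \<cdot> \<Delta>)"
    unfolding s12 by (simp add: cmp_tensor_ended_strand)
  show ?thesis
    unfolding pre_braiding_def sigma_coAss_def
    using lhs rhs coassoc by (simp add: Hom_iff)
qed

lemma braided_cocharacter_sigma_coAss:
  assumes "counital_coassociative_coalgebra C V \<Delta> \<epsilon>" "coalgebra_cocharacter C V \<Delta> \<epsilon> e"
  shows "braided_cocharacter C V (sigma_coAss C \<Delta> \<epsilon>) e"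
  using assms counit_tensor_cmp_cocharacter[of e V \<epsilon> \<Delta>]
  by (simp add: braided_cocharacter_def sigma_coAss_def coalgebra_cocharacter_def
      counital_coassociative_coalgebra_def)

end

section \<open>Perturbing an involution in a ring\<close>

text \<open>With \<open>c\<^sub>i\<close> the symmetry and \<open>t\<^sub>i\<close> the perturbation on the strands \<open>i\<close> and \<open>i + 1\<close>, the mixed
  conditions \<open>(c\<^sub>i \<otimes> c\<^sub>j) \<otimes> t\<^sub>i = t\<^sub>j \<otimes> (c\<^sub>i \<otimes> c\<^sub>j)\<close> say that \<open>t\<close> is natural for \<open>c\<close>. They
  match the terms with one \<open>t\<close> in the two expanded products, and the vanishing conditions
  leave only the three terms of \<open>leibniz\<close>.\<close>

lemma (in ring) yang_baxter_perturbation: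
  assumes carr [simp]: "c1 \<in> carrier R" "c2 \<in> carrier R" "t1 \<in> carrier R" "t2 \<in> carrier R"
    and invol: "c1 \<otimes> c1 = \<one>" "c2 \<otimes> c2 = \<one>"
    and yb: "c1 \<otimes> (c2 \<otimes> c1) = c2 \<otimes> (c1 \<otimes> c2)"
    and nat1: "c1 \<otimes> (c2 \<otimes> t1) = t2 \<otimes> (c1 \<otimes> c2)"
    and nat2: "c2 \<otimes> (c1 \<otimes> t2) = t1 \<otimes> (c2 \<otimes> c1)"
    and zero: "t2 \<otimes> t1 = \<zero>" "t1 \<otimes> (c2 \<otimes> t1) = \<zero>"
    and leibniz: "t1 \<otimes> (t2 \<otimes> c1) = t2 \<otimes> (c1 \<otimes> t2) \<oplus> c2 \<otimes> (t1 \<otimes> t2)"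
  shows "(c1 \<oplus> t1) \<otimes> ((c2 \<oplus> t2) \<otimes> (c1 \<oplus> t1)) = (c2 \<oplus> t2) \<otimes> ((c1 \<oplus> t1) \<otimes> (c2 \<oplus> t2))"
proof -
  have cancel: "c1 \<otimes> (c1 \<otimes> x) = x" "c2 \<otimes> (c2 \<otimes> x) = x" if "x \<in> carrier R" for x
    using that invol by (simp_all flip: m_assoc)
  \<comment> \<open>By \<open>nat1\<close>, \<open>t2\<close> is the conjugate of \<open>t1\<close> by \<open>c1 \<otimes> c2\<close>; conjugating once more by \<open>c1\<close>
    leaves the conjugate of \<open>t1\<close> by \<open>c2\<close>.\<close>
  have "c1 \<otimes> (t2 \<otimes> c1) = c1 \<otimes> (t2 \<otimes> (c1 \<otimes> (c2 \<otimes> c2)))"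
    by (simp add: invol)
  also have "\<dots> = c1 \<otimes> ((t2 \<otimes> (c1 \<otimes> c2)) \<otimes> c2)"
    by (simp add: m_assoc)
  also have "\<dots> = c2 \<otimes> (t1 \<otimes> c2)"
    by (simp add: m_assoc cancel flip: nat1)
  finally have conj: "c1 \<otimes> (t2 \<otimes> c1) = c2 \<otimes> (t1 \<otimes> c2)" .
  have t21: "t2 \<otimes> (t1 \<otimes> x) = \<zero>" if "x \<in> carrier R" for x
    using that zero(1) by (simp flip: m_assoc)
  show ?thesis
    by (simp add: l_distr r_distr m_assoc yb nat1 nat2 zero leibniz conj t21 a_ac)
qed

text \<open>Since \<open>c \<oplus> t = (\<one> \<oplus> t \<otimes> c) \<otimes> c\<close>, and \<open>t \<otimes> c\<close> squares to zero, the inverse is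
  \<open>c \<otimes> (\<one> \<ominus> t \<otimes> c)\<close>.\<close>

lemma (in ring) involution_perturbation_inverse:
  assumes carr [simp]: "c \<in> carrier R" "t \<in> carrier R"
    and invol: "c \<otimes> c = \<one>" and zero: "t \<otimes> (c \<otimes> t) = \<zero>"
  shows "(c \<oplus> t) \<otimes> (c \<oplus> \<ominus> (c \<otimes> (t \<otimes> c))) = \<one>"
    and "(c \<oplus> \<ominus> (c \<otimes> (t \<otimes> c))) \<otimes> (c \<oplus> t) = \<one>"
proof -
  have cancel: "c \<otimes> (c \<otimes> x) = x" if "x \<in> carrier R" for x
    using that invol by (simp flip: m_assoc)
  have tct: "t \<otimes> (c \<otimes> (t \<otimes> x)) = \<zero>" if "x \<in> carrier R" for x
  proof -
    have "t \<otimes> (c \<otimes> (t \<otimes> x)) = (t \<otimes> (c \<otimes> t)) \<otimes> x"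
      using that by (simp add: m_assoc)
    then show ?thesis using that by (simp add: zero)
  qed
  show "(c \<oplus> t) \<otimes> (c \<oplus> \<ominus> (c \<otimes> (t \<otimes> c))) = \<one>"
    by (simp add: l_distr r_distr l_minus r_minus m_assoc invol cancel tct zero a_ac r_neg)
  show "(c \<oplus> \<ominus> (c \<otimes> (t \<otimes> c))) \<otimes> (c \<oplus> t) = \<one>"
    by (simp add: l_distr r_distr l_minus r_minus m_assoc invol cancel tct zero a_ac r_neg)
qed

section \<open>Endomorphism rings\<close>

context preadditive_strict_monoidal_category
begin

lemma hom_group_simps:
  "carrier (hom_group C A B) = Hom A B" "mult (hom_group C A B) f g = f \<boxplus> g"
  "one (hom_group C A B) = \<z> A B"
  by (simp_all add: hom_group_def)

lemma add_in_Hom: "\<lbrakk>f \<in> Hom A B; g \<in> Hom A B\<rbrakk> \<Longrightarrow> f \<boxplus> g \<in> Hom A B"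
  using hom_comm_group[of A B] Dom_in_Obj Cod_in_Obj
  by (metis comm_groupE(1) hom_group_simps(1,2) Hom_iff)

lemma zero_in_Hom: "\<lbrakk>A \<in> Obj C; B \<in> Obj C\<rbrakk> \<Longrightarrow> \<z> A B \<in> Hom A B"
  using hom_comm_group[of A B] by (metis comm_groupE(2) hom_group_simps(1,3))

lemma zero_typing [simp]:
  assumes "A \<in> Obj C" "B \<in> Obj C"
  shows "\<z> A B \<in> Arr C" "Dom C (\<z> A B) = A" "Cod C (\<z> A B) = B"
  using zero_in_Hom[OF assms] by (simp_all add: Hom_iff)

lemma zero_unique:
  assumes "f \<in> Hom A B" "f \<boxplus> f = f"
  shows "f = \<z> A B"
proof -
  have AB: "A \<in> Obj C" "B \<in> Obj C"
    using assms Dom_in_Obj Cod_in_Obj by (auto simp: Hom_iff)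
  interpret comm_group "hom_group C A B" using AB by (rule hom_comm_group)
  show ?thesis
    using assms r_cancel_one[of f f] by (simp add: hom_group_simps)
qed

lemma add_zero: "f \<in> Hom A B \<Longrightarrow> f \<boxplus> \<z> A B = f"
proof -
  assume f: "f \<in> Hom A B"
  then have AB: "A \<in> Obj C" "B \<in> Obj C"
    using Dom_in_Obj Cod_in_Obj by (auto simp: Hom_iff)
  interpret comm_group "hom_group C A B" using AB by (rule hom_comm_group)
  show ?thesis using f r_one[of f] by (simp add: hom_group_simps)
qed

lemma diff_eqD:
  assumes "h = f \<boxminus> g" "f \<in> Hom A B" "g \<in> Hom A B"
  shows "f = h \<boxplus> g"
proof -
  have AB: "A \<in> Obj C" "B \<in> Obj C"
    using assms Dom_in_Obj Cod_in_Obj by (auto simp: Hom_iff)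
  interpret G: comm_group "hom_group C A B" using AB by (rule hom_comm_group)
  show ?thesis
    using assms G.m_assoc[of f "m_inv (hom_group C A B) g" g] G.l_inv[of g] G.inv_closed[of g]
    by (simp add: diff_arr_def hom_group_simps Hom_iff add_zero)
qed

lemma zero_absorbing:
  assumes "f \<in> Arr C" "A \<in> Obj C" "B \<in> Obj C"
  shows cmp_zero: "Dom C f = B \<Longrightarrow> f \<cdot> \<z> A B = \<z> A (Cod C f)"
    and zero_cmp: "Cod C f = A \<Longrightarrow> \<z> A B \<cdot> f = \<z> (Dom C f) B"
    and tensor_zero: "f \<otimes>\<^sub>m \<z> A B = \<z> (Dom C f \<otimes>\<^sub>o A) (Cod C f \<otimes>\<^sub>o B)"
    and zero_tensor: "\<z> A B \<otimes>\<^sub>m f = \<z> (A \<otimes>\<^sub>o Dom C f) (B \<otimes>\<^sub>o Cod C f)"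
proof -
  have zz: "\<z> A B \<boxplus> \<z> A B = \<z> A B" and z: "\<z> A B \<in> Hom A B"
    using assms by (simp_all add: add_zero zero_in_Hom)
  have f: "f \<in> Hom (Dom C f) (Cod C f)"
    using assms by (simp add: Hom_iff)
  show "f \<cdot> \<z> A B = \<z> A (Cod C f)" if "Dom C f = B"
    by (rule zero_unique) (use assms that f z cmp_add_right[of f B _ "\<z> A B" A "\<z> A B"] in
        \<open>auto simp: zz Hom_iff\<close>)
  show "\<z> A B \<cdot> f = \<z> (Dom C f) B" if "Cod C f = A"
    by (rule zero_unique) (use assms that f z cmp_add_left[of "\<z> A B" A B "\<z> A B" f] in
        \<open>auto simp: zz Hom_iff\<close>)
  show "f \<otimes>\<^sub>m \<z> A B = \<z> (Dom C f \<otimes>\<^sub>o A) (Cod C f \<otimes>\<^sub>o B)"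
    by (rule zero_unique) (use assms tensor_add_right[OF f z z] in \<open>auto simp: zz Hom_iff\<close>)
  show "\<z> A B \<otimes>\<^sub>m f = \<z> (A \<otimes>\<^sub>o Dom C f) (B \<otimes>\<^sub>o Cod C f)"
    by (rule zero_unique) (use assms tensor_add_left[OF z z f] in \<open>auto simp: zz Hom_iff\<close>)
qed

definition endo_ring :: "'o \<Rightarrow> 'm ring"
  where "endo_ring A =
    \<lparr>carrier = Hom A A, monoid.mult = cmp C, one = \<i>\<d> A, zero = \<z> A A, add = add_arr C\<rparr>"

lemma endo_ring_simps:
  "carrier (endo_ring A) = Hom A A" "mult (endo_ring A) f g = f \<cdot> g"
  "one (endo_ring A) = \<i>\<d> A" "zero (endo_ring A) = \<z> A A" "add (endo_ring A) f g = f \<boxplus> g"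
  by (simp_all add: endo_ring_def)

lemma ring_endo_ring:
  assumes A: "A \<in> Obj C"
  shows "ring (endo_ring A)"
proof (rule ringI)
  have "comm_group (add_monoid (endo_ring A))"
    using hom_comm_group[OF A A] by (simp add: hom_group_def endo_ring_def)
  then show "abelian_group (endo_ring A)"
    by (simp add: abelian_group_def abelian_group_axioms_def abelian_monoid_def comm_group_def)
  show "Group.monoid (endo_ring A)"
    using A by unfold_locales (auto simp: endo_ring_simps Hom_iff cmp_assoc_Arr)
qed (auto simp: endo_ring_simps intro: cmp_add_left cmp_add_right)

end

section \<open>Co-Leibniz coalgebras\<close>

context symmetric_strict_monoidal_category
begin

lemma braid_typing [simp]:
  assumes "A \<in> Obj C" "B \<in> Obj C"
  shows "c A B \<in> Arr C" "Dom C (c A B) = A \<otimes>\<^sub>o B" "Cod C (c A B) = B \<otimes>\<^sub>o A"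
  using braid_in_Hom[OF assms] by (simp_all add: Hom_iff)

text \<open>The hexagon at two unit objects makes the invertible arrow \<open>c A \<I>\<close> idempotent.\<close>

lemma braid_unit:
  assumes A [simp]: "A \<in> Obj C"
  shows "c A \<I> = \<i>\<d> A" "c \<I> A = \<i>\<d> A"
proof -
  have "c A \<I> = c A \<I> \<cdot> c A \<I>"
    using braid_tensor_right[of A \<I> \<I>] by simp
  then have "c \<I> A \<cdot> c A \<I> = (c \<I> A \<cdot> c A \<I>) \<cdot> c A \<I>"
    by (simp add: cmp_assoc_Arr)
  then show *: "c A \<I> = \<i>\<d> A"
    using braid_symmetric[of A \<I>] by simp
  show "c \<I> A = \<i>\<d> A"
    using braid_symmetric[of A \<I>] * by simp
qed

lemma counit_braid:
  assumes "V \<in> Obj C" "\<epsilon> \<in> Hom V \<I>"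
  shows "(\<i>\<d> V \<otimes>\<^sub>m \<epsilon>) \<cdot> c V V = \<epsilon> \<otimes>\<^sub>m \<i>\<d> V" "(\<epsilon> \<otimes>\<^sub>m \<i>\<d> V) \<cdot> c V V = \<i>\<d> V \<otimes>\<^sub>m \<epsilon>"
  using assms braid_natural[of \<epsilon> V \<I> "\<i>\<d> V" V V] braid_natural[of "\<i>\<d> V" V V \<epsilon> V \<I>]
  by (simp_all add: braid_unit Hom_iff)

text \<open>Any endomorphism of \<open>V \<otimes>\<^sub>o V\<close> can be pulled through a third strand. For the symmetry itself
  this is the Yang--Baxter equation.\<close>

lemma braid_pull_through:
  assumes [simp]: "V \<in> Obj C" and "s \<in> Hom (V \<otimes>\<^sub>o V) (V \<otimes>\<^sub>o V)"
  defines "c1 \<equiv> c V V \<otimes>\<^sub>m \<i>\<d> V" and "c2 \<equiv> \<i>\<d> V \<otimes>\<^sub>m c V V"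
  shows "c1 \<cdot> c2 \<cdot> (s \<otimes>\<^sub>m \<i>\<d> V) = (\<i>\<d> V \<otimes>\<^sub>m s) \<cdot> c1 \<cdot> c2"
    and "c2 \<cdot> c1 \<cdot> (\<i>\<d> V \<otimes>\<^sub>m s) = (s \<otimes>\<^sub>m \<i>\<d> V) \<cdot> c2 \<cdot> c1"
proof -
  have [simp]: "s \<in> Arr C" "Dom C s = V \<otimes>\<^sub>o V" "Cod C s = V \<otimes>\<^sub>o V"
    using assms by (simp_all add: Hom_iff)
  have "(c1 \<cdot> c2) \<cdot> (s \<otimes>\<^sub>m \<i>\<d> V) = (\<i>\<d> V \<otimes>\<^sub>m s) \<cdot> c1 \<cdot> c2"
    using braid_natural[of s "V \<otimes>\<^sub>o V" "V \<otimes>\<^sub>o V" "\<i>\<d> V" V V] braid_tensor_left[of V V V]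
    by (simp add: c1_def c2_def Hom_iff)
  then show "c1 \<cdot> c2 \<cdot> (s \<otimes>\<^sub>m \<i>\<d> V) = (\<i>\<d> V \<otimes>\<^sub>m s) \<cdot> c1 \<cdot> c2"
    by (simp add: c1_def c2_def cmp_assoc_Arr)
  have "(c2 \<cdot> c1) \<cdot> (\<i>\<d> V \<otimes>\<^sub>m s) = (s \<otimes>\<^sub>m \<i>\<d> V) \<cdot> c2 \<cdot> c1"
    using braid_natural[of "\<i>\<d> V" V V s "V \<otimes>\<^sub>o V" "V \<otimes>\<^sub>o V"] braid_tensor_right[of V V V]
    by (simp add: c1_def c2_def Hom_iff)
  then show "c2 \<cdot> c1 \<cdot> (\<i>\<d> V \<otimes>\<^sub>m s) = (s \<otimes>\<^sub>m \<i>\<d> V) \<cdot> c2 \<cdot> c1"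
    by (simp add: c1_def c2_def cmp_assoc_Arr)
qed

end

context symmetric_preadditive_strict_monoidal_category
begin

context
  fixes V \<delta> \<epsilon>
  assumes coLei: "counital_coLeibniz_coalgebra C c V \<delta> \<epsilon>"
begin

abbreviation "c1 \<equiv> c V V \<otimes>\<^sub>m \<i>\<d> V"
abbreviation "c2 \<equiv> \<i>\<d> V \<otimes>\<^sub>m c V V"
abbreviation "t1 \<equiv> \<epsilon> \<otimes>\<^sub>m \<delta> \<otimes>\<^sub>m \<i>\<d> V"
abbreviation "t2 \<equiv> \<i>\<d> V \<otimes>\<^sub>m \<epsilon> \<otimes>\<^sub>m \<delta>"

lemma coLei_typing [simp]:
  "V \<in> Obj C"
  "\<delta> \<in> Arr C" "Dom C \<delta> = V" "Cod C \<delta> = V \<otimes>\<^sub>o V"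
  "\<epsilon> \<in> Arr C" "Dom C \<epsilon> = V" "Cod C \<epsilon> = \<I>"
  using coLei by (simp_all add: counital_coLeibniz_coalgebra_def Hom_iff)

lemma coLei_counit: "(\<i>\<d> V \<otimes>\<^sub>m \<epsilon>) \<cdot> \<delta> = \<z> V V" "(\<epsilon> \<otimes>\<^sub>m \<i>\<d> V) \<cdot> \<delta> = \<z> V V"
  using coLei by (simp_all add: counital_coLeibniz_coalgebra_def)

lemma coLei_identity:
  "(\<delta> \<otimes>\<^sub>m \<i>\<d> V) \<cdot> \<delta> = (\<i>\<d> V \<otimes>\<^sub>m \<delta>) \<cdot> \<delta> \<boxplus> c2 \<cdot> (\<delta> \<otimes>\<^sub>m \<i>\<d> V) \<cdot> \<delta>"
proof (rule diff_eqD)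
  show "(\<i>\<d> V \<otimes>\<^sub>m \<delta>) \<cdot> \<delta> = (\<delta> \<otimes>\<^sub>m \<i>\<d> V) \<cdot> \<delta> \<boxminus> c2 \<cdot> (\<delta> \<otimes>\<^sub>m \<i>\<d> V) \<cdot> \<delta>"
    using coLei by (simp add: counital_coLeibniz_coalgebra_def)
qed (simp_all add: Hom_iff)

text \<open>In the products \<open>t c t\<close>, \<open>t2 t1\<close> and \<open>t1 c2 t1\<close>, the counit of the left factor lands on a leg
  of the \<open>\<delta>\<close> of the right factor: in \<open>t c t\<close> on its second leg, which \<open>c\<close> brings to
  the first strand, in \<open>t2 t1\<close> on its second leg and in \<open>t1 c2 t1\<close> on its first.\<close>

lemma t_c_t: "(\<epsilon> \<otimes>\<^sub>m \<delta>) \<cdot> c V V \<cdot> (\<epsilon> \<otimes>\<^sub>m \<delta>) = \<z> (V \<otimes>\<^sub>o V) (V \<otimes>\<^sub>o V)"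
proof -
  have "(\<epsilon> \<otimes>\<^sub>m \<delta>) \<cdot> c V V = \<delta> \<cdot> (\<epsilon> \<otimes>\<^sub>m \<i>\<d> V) \<cdot> c V V"
    using cmp_assoc_Arr[of "c V V" "\<epsilon> \<otimes>\<^sub>m \<i>\<d> V" \<delta>] by (simp add: cmp_tensor_ended_strand)
  also have "\<dots> = \<delta> \<cdot> (\<i>\<d> V \<otimes>\<^sub>m \<epsilon>)"
    by (simp add: counit_braid Hom_iff)
  finally have "((\<epsilon> \<otimes>\<^sub>m \<delta>) \<cdot> c V V) \<cdot> \<delta> = \<z> V (V \<otimes>\<^sub>o V)"
    by (simp add: cmp_assoc_Arr coLei_counit cmp_zero)
  then have "(\<epsilon> \<otimes>\<^sub>m \<delta>) \<cdot> c V V \<cdot> \<delta> = \<z> V (V \<otimes>\<^sub>o V)"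
    by (simp add: cmp_assoc_Arr)
  then show ?thesis
    by (simp add: cmp_tensor_ended_strand tensor_zero)
qed

lemma t2_t1: "t2 \<cdot> t1 = \<z> (V \<otimes>\<^sub>o V \<otimes>\<^sub>o V) (V \<otimes>\<^sub>o V \<otimes>\<^sub>o V)"
proof -
  have "t2 \<cdot> (\<delta> \<otimes>\<^sub>m \<i>\<d> V) = \<z> (V \<otimes>\<^sub>o V) (V \<otimes>\<^sub>o V \<otimes>\<^sub>o V)"
    using interchange_Arr[of \<delta> "\<i>\<d> V \<otimes>\<^sub>m \<epsilon>" "\<i>\<d> V" \<delta>] by (simp add: coLei_counit zero_tensor)
  then show ?thesis
    by (simp add: cmp_tensor_ended_strand tensor_zero)
qed

lemma t1_c2_t1: "t1 \<cdot> c2 \<cdot> t1 = \<z> (V \<otimes>\<^sub>o V \<otimes>\<^sub>o V) (V \<otimes>\<^sub>o V \<otimes>\<^sub>o V)"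
proof -
  let ?h = "(\<delta> \<otimes>\<^sub>m \<i>\<d> V) \<cdot> c V V"
  have "t1 \<cdot> c2 = \<epsilon> \<otimes>\<^sub>m ?h"
    by (simp add: interchange_Arr)
  also have "\<dots> = ?h \<cdot> (\<epsilon> \<otimes>\<^sub>m \<i>\<d> (V \<otimes>\<^sub>o V))"
    by (simp add: cmp_tensor_ended_strand)
  finally have *: "t1 \<cdot> c2 = ?h \<cdot> (\<epsilon> \<otimes>\<^sub>m \<i>\<d> V \<otimes>\<^sub>m \<i>\<d> V)" by simp
  have "(\<epsilon> \<otimes>\<^sub>m \<i>\<d> V \<otimes>\<^sub>m \<i>\<d> V) \<cdot> (\<delta> \<otimes>\<^sub>m \<i>\<d> V) = \<z> (V \<otimes>\<^sub>o V) (V \<otimes>\<^sub>o V)"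
    using interchange_Arr[of \<delta> "\<epsilon> \<otimes>\<^sub>m \<i>\<d> V" "\<i>\<d> V" "\<i>\<d> V"]
    by (simp add: coLei_counit zero_tensor del: tensor_ident)
  then have "(t1 \<cdot> c2) \<cdot> (\<delta> \<otimes>\<^sub>m \<i>\<d> V) = \<z> (V \<otimes>\<^sub>o V) (V \<otimes>\<^sub>o V \<otimes>\<^sub>o V)"
    unfolding * by (simp add: cmp_assoc_Arr cmp_zero del: tensor_ident)
  then have "(t1 \<cdot> c2) \<cdot> t1 = \<z> (V \<otimes>\<^sub>o V \<otimes>\<^sub>o V) (V \<otimes>\<^sub>o V \<otimes>\<^sub>o V)"
    by (simp add: cmp_tensor_ended_strand tensor_zero)
  then show ?thesis
    by (simp add: cmp_assoc_Arr)
qed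

text \<open>All three terms carry counits on the first two strands; on the third they read off the three
  terms of the co-Leibniz identity.\<close>

lemma t1_t2_c1: "t1 \<cdot> t2 \<cdot> c1 = t2 \<cdot> c1 \<cdot> t2 \<boxplus> c2 \<cdot> t1 \<cdot> t2"
proof -
  have t2c1: "t2 \<cdot> c1 = \<epsilon> \<otimes>\<^sub>m \<i>\<d> V \<otimes>\<^sub>m \<delta>"
    using interchange_Arr[of "c V V" "\<i>\<d> V \<otimes>\<^sub>m \<epsilon>" "\<i>\<d> V" \<delta>] by (simp add: counit_braid Hom_iff)
  have lhs: "t1 \<cdot> t2 \<cdot> c1 = \<epsilon> \<otimes>\<^sub>m \<epsilon> \<otimes>\<^sub>m ((\<delta> \<otimes>\<^sub>m \<i>\<d> V) \<cdot> \<delta>)"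
    unfolding t2c1 by (simp add: cmp_tensor_ended_strand interchange_Arr)
  have "(t2 \<cdot> c1) \<cdot> t2 = \<epsilon> \<otimes>\<^sub>m \<epsilon> \<otimes>\<^sub>m ((\<i>\<d> V \<otimes>\<^sub>m \<delta>) \<cdot> \<delta>)"
    unfolding t2c1 by (simp add: cmp_tensor_ended_strand interchange_Arr)
  then have rhs1: "t2 \<cdot> c1 \<cdot> t2 = \<epsilon> \<otimes>\<^sub>m \<epsilon> \<otimes>\<^sub>m ((\<i>\<d> V \<otimes>\<^sub>m \<delta>) \<cdot> \<delta>)"
    by (simp add: cmp_assoc_Arr)
  have "t1 \<cdot> t2 = \<epsilon> \<otimes>\<^sub>m \<epsilon> \<otimes>\<^sub>m ((\<delta> \<otimes>\<^sub>m \<i>\<d> V) \<cdot> \<delta>)"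
    by (simp add: cmp_tensor_ended_strand interchange_Arr)
  then have rhs2: "c2 \<cdot> t1 \<cdot> t2 = \<epsilon> \<otimes>\<^sub>m \<epsilon> \<otimes>\<^sub>m (c2 \<cdot> (\<delta> \<otimes>\<^sub>m \<i>\<d> V) \<cdot> \<delta>)"
    by (simp add: cmp_tensor_ended_strand)
  have add: "f \<otimes>\<^sub>m (g \<boxplus> g') = f \<otimes>\<^sub>m g \<boxplus> f \<otimes>\<^sub>m g'"
    if "f \<in> Arr C" "g \<in> Arr C" "g' \<in> Arr C" "Dom C g = Dom C g'" "Cod C g = Cod C g'" for f g g'
    using that by (intro tensor_add_right) (simp_all add: Hom_iff)
  show ?thesis
    unfolding lhs rhs1 rhs2 by (subst coLei_identity) (simp add: add)
qed

lemma braiding_sigma_coLei: "braiding C V (sigma_coLei C c V \<delta> \<epsilon>)"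
proof -
  let ?t = "\<epsilon> \<otimes>\<^sub>m \<delta>" and ?V2 = "V \<otimes>\<^sub>o V" and ?V3 = "V \<otimes>\<^sub>o V \<otimes>\<^sub>o V"
  let ?s = "c V V \<boxplus> ?t"
  have c: "c V V \<in> Hom ?V2 ?V2" and t: "?t \<in> Hom ?V2 ?V2" and i: "\<i>\<d> V \<in> Hom V V"
    by (simp_all add: Hom_iff)
  have s: "?s \<in> Hom ?V2 ?V2"
    using c t by (rule add_in_Hom)
  interpret R2: ring "endo_ring ?V2" by (simp add: ring_endo_ring)
  interpret R3: ring "endo_ring ?V3" by (simp add: ring_endo_ring)
  have cc: "c V V \<cdot> c V V = \<i>\<d> ?V2"
    by (simp add: braid_symmetric)
  have "(c1 \<boxplus> t1) \<cdot> (c2 \<boxplus> t2) \<cdot> (c1 \<boxplus> t1) = (c2 \<boxplus> t2) \<cdot> (c1 \<boxplus> t1) \<cdot> (c2 \<boxplus> t2)"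
  proof (rule R3.yang_baxter_perturbation[unfolded endo_ring_simps])
    show "c1 \<cdot> c1 = \<i>\<d> ?V3" "c2 \<cdot> c2 = \<i>\<d> ?V3"
      by (simp_all add: interchange_Arr cc)
    show "c1 \<cdot> c2 \<cdot> c1 = c2 \<cdot> c1 \<cdot> c2"
      using braid_pull_through(1)[OF _ c] by simp
    show "c1 \<cdot> c2 \<cdot> t1 = t2 \<cdot> c1 \<cdot> c2" "c2 \<cdot> c1 \<cdot> t2 = t1 \<cdot> c2 \<cdot> c1"
      using braid_pull_through[OF _ t] by simp_all
  qed (simp_all add: Hom_iff t2_t1 t1_c2_t1 t1_t2_c1)
  moreover have "?s \<otimes>\<^sub>m \<i>\<d> V = c1 \<boxplus> t1" "\<i>\<d> V \<otimes>\<^sub>m ?s = c2 \<boxplus> t2"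
    using tensor_add_left[OF c t i] tensor_add_right[OF i c t] by simp_all
  ultimately have pre: "pre_braiding C V ?s"
    using s by (simp add: pre_braiding_def)
  define u where "u = c V V \<boxplus> (\<ominus>\<^bsub>endo_ring ?V2\<^esub> (c V V \<cdot> ?t \<cdot> c V V))"
  have "c V V \<cdot> ?t \<cdot> c V V \<in> Hom ?V2 ?V2"
    by (simp add: Hom_iff)
  then have u: "u \<in> Hom ?V2 ?V2"
    unfolding u_def using R2.a_inv_closed c by (intro add_in_Hom) (simp_all add: endo_ring_simps)
  have "?s \<cdot> u = \<i>\<d> ?V2" "u \<cdot> ?s = \<i>\<d> ?V2"
    unfolding u_def
    using R2.involution_perturbation_inverse[of "c V V" ?t, unfolded endo_ring_simps] c t cc t_c_t
    by simp_all
  then show ?thesis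
    using pre s u by (auto simp: braiding_def is_iso_def sigma_coLei_def)
qed

lemma braided_cocharacter_sigma_coLei:
  assumes "coLie_cocharacter C V \<delta> \<epsilon> e"
  shows "braided_cocharacter C V (sigma_coLei C c V \<delta> \<epsilon>) e"
proof -
  have e: "e \<in> Hom \<I> V" and de: "\<delta> \<cdot> e = \<z> \<I> (V \<otimes>\<^sub>o V)" and ee: "\<epsilon> \<cdot> e = \<i>\<d> \<I>"
    using assms by (simp_all add: coLie_cocharacter_def)
  have eV: "e \<otimes>\<^sub>m e \<in> Hom \<I> (V \<otimes>\<^sub>o V)"
    using e by (simp add: Hom_iff)
  have "sigma_coLei C c V \<delta> \<epsilon> \<cdot> (e \<otimes>\<^sub>m e) = c V V \<cdot> (e \<otimes>\<^sub>m e) \<boxplus> (\<epsilon> \<otimes>\<^sub>m \<delta>) \<cdot> (e \<otimes>\<^sub>m e)"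
    unfolding sigma_coLei_def by (rule cmp_add_left[OF _ _ eV]) (simp_all add: Hom_iff)
  also have "c V V \<cdot> (e \<otimes>\<^sub>m e) = e \<otimes>\<^sub>m e"
    using braid_natural[OF e e] e by (simp add: braid_unit Hom_iff)
  also have "(\<epsilon> \<otimes>\<^sub>m \<delta>) \<cdot> (e \<otimes>\<^sub>m e) = \<z> \<I> (V \<otimes>\<^sub>o V)"
    using counit_tensor_cmp_cocharacter[OF e _ _ ee] de by (simp add: Hom_iff)
  finally show ?thesis
    using e eV by (simp add: braided_cocharacter_def add_zero)
qed

end

end

theorem mainTheorem16:
  fixes C :: "('o1, 'm1) monoidal_category"
    and D :: "('o2, 'm2) preadditive_monoidal_category"
  shows
    "(\<forall>V \<Delta> \<epsilon>.
        strict_monoidal_category C \<longrightarrow>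
        counital_coassociative_coalgebra C V \<Delta> \<epsilon> \<longrightarrow>
          pre_braiding C V (sigma_coAss C \<Delta> \<epsilon>) \<and>
          (\<forall>e. coalgebra_cocharacter C V \<Delta> \<epsilon> e \<longrightarrow>
               braided_cocharacter C V (sigma_coAss C \<Delta> \<epsilon>) e)) \<and>
     (\<forall>c V \<delta> \<epsilon>.
        symmetric_preadditive_strict_monoidal_category D c \<longrightarrow>
        counital_coLeibniz_coalgebra D c V \<delta> \<epsilon> \<longrightarrow>
          braiding D V (sigma_coLei D c V \<delta> \<epsilon>) \<and>
          (\<forall>e. coLie_cocharacter D V \<delta> \<epsilon> e \<longrightarrow>
               braided_cocharacter D V (sigma_coLei D c V \<delta> \<epsilon>) e))"
proof -
  have "pre_braiding C V (sigma_coAss C \<Delta> \<epsilon>) \<and>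
      (\<forall>e. coalgebra_cocharacter C V \<Delta> \<epsilon> e \<longrightarrow>
        braided_cocharacter C V (sigma_coAss C \<Delta> \<epsilon>) e)"
    if "strict_monoidal_category C" "counital_coassociative_coalgebra C V \<Delta> \<epsilon>" for V \<Delta> \<epsilon>
  proof -
    interpret strict_monoidal_category C by fact
    show ?thesis
      using pre_braiding_sigma_coAss braided_cocharacter_sigma_coAss that(2) by blast
  qed
  moreover have "braiding D V (sigma_coLei D c V \<delta> \<epsilon>) \<and>
      (\<forall>e. coLie_cocharacter D V \<delta> \<epsilon> e \<longrightarrow>
        braided_cocharacter D V (sigma_coLei D c V \<delta> \<epsilon>) e)"
    if "symmetric_preadditive_strict_monoidal_category D c"
      "counital_coLeibniz_coalgebra D c V \<delta> \<epsilon>" for c V \<delta> \<epsilon>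
  proof -
    interpret symmetric_preadditive_strict_monoidal_category D c by fact
    show ?thesis
      using braiding_sigma_coLei braided_cocharacter_sigma_coLei that(2) by blast
  qed
  ultimately show ?thesis by blast
qed

end
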